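(* Let $I\subseteq\mathbb R$ be an interval, let $\phi:\mathbb R\times I\to\mathbb R$ and $\kappa:\mathbb R\times I\to\mathbb R_+$, and suppose that $\kappa$ is TP2. Assume that: (i) for every $m\in I$, the map $\ell\mapsto\phi(\ell,m)$ is single crossing; (ii) there exist $-\infty\le\underline m\le\bar m\le\infty$ such that, for every $\ell\in\mathbb R$, the map $m\mapsto\phi(\ell,m)$ is nonpositive on $I\cap(-\infty,\underline m]$, nondecreasing on $I\cap(\underline m,\bar m)$, and nonnegative on $I\cap[\bar m,\infty)$; (iii) for every $\ell$ and $m$ in $I$, the map $k\mapsto\phi(k,\ell)\kappa(k,m)$ is integrable (with respect to Lebesgue measure on $\mathbb R$). Then the map $m\mapsto\int_{\mathbb R}\phi(\ell,m)\kappa(\ell,m)\,\mathrm d\ell$ is single crossing on $I$.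
   Context: For non-empty $J\subseteq\mathbb R$, a map $\psi:J\to\mathbb R$ is single crossing if, for all $m\le m'$ in $J$, $\psi(m)>0$ implies $\psi(m')\ge0$. A map $\kappa:\mathbb R\times I\to\mathbb R_+$ is TP2 (totally positive of order 2) if $\kappa(\ell,m)\kappa(\ell',m')\ge\kappa(\ell,m')\kappa(\ell',m)$ whenever $\ell\le\ell'$ in $\mathbb R$ and $m\le m'$ in $I$. *)

theory Defs
  imports "HOL-Analysis.Analysis"
begin

definition single_crossing_on :: "real set \<Rightarrow> (real \<Rightarrow> real) \<Rightarrow> bool" where
  "single_crossing_on J \<psi> \<longleftrightarrow>
     (\<forall>m\<in>J. \<forall>m'\<in>J. m \<le> m' \<longrightarrow> \<psi> m > 0 \<longrightarrow> \<psi> m' \<ge> 0)"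

text \<open>Maps on \<open>\<real> \<times> I\<close> are curried; values at second arguments outside
  \<open>I\<close> are irrelevant.  Nonnegativity of \<open>\<kappa>\<close> is not part of this definition.\<close>

definition TP2_on :: "real set \<Rightarrow> (real \<Rightarrow> real \<Rightarrow> real) \<Rightarrow> bool" where
  "TP2_on I \<kappa> \<longleftrightarrow>
     (\<forall>l l'. \<forall>m\<in>I. \<forall>m'\<in>I. l \<le> l' \<longrightarrow> m \<le> m' \<longrightarrow>
        \<kappa> l m * \<kappa> l' m' \<ge> \<kappa> l m' * \<kappa> l' m)"

end

theory Submission
  imports Defs
begin

text \<open>
  The two outer regions of assumption (ii) are immediate, and between them monotonicity in \<open>m\<close>
  gives \<open>0 < \<integral> \<phi>(l,m) \<kappa>(l,m) \<le> \<integral> \<phi>(l,m') \<kappa>(l,m)\<close>, so only the weight \<open>\<kappa>\<close> has to be changed.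
  For this write \<open>f = \<phi>(\<cdot>,m')\<close>, \<open>g = \<kappa>(\<cdot>,m)\<close>, \<open>h = \<kappa>(\<cdot>,m')\<close> and let \<open>P\<close>, \<open>N\<close> be the positive and
  negative parts of \<open>f\<close>.  Single crossing puts the support of \<open>N\<close> to the left of that of \<open>P\<close>, so
  integrating the TP2 inequality against \<open>N(x) P(y)\<close> yields \<open>\<integral>N h \<integral>P g \<le> \<integral>N g \<integral>P h\<close>.  Together
  with \<open>\<integral>N g < \<integral>P g\<close> this forces \<open>\<integral>N h \<le> \<integral>P h\<close>.
\<close>

lemma integral_single_crossing_change_weight:
  fixes f g h :: "real \<Rightarrow> real"
  assumes f: "single_crossing_on UNIV f"
    and g: "\<And>x. 0 \<le> g x" and h: "\<And>x. 0 \<le> h x"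
    and gh: "\<And>x y. x \<le> y \<Longrightarrow> h x * g y \<le> g x * h y"
    and fg: "integrable M (\<lambda>x. f x * g x)" and fh: "integrable M (\<lambda>x. f x * h x)"
    and pos: "0 < (\<integral>x. f x * g x \<partial>M)"
  shows "0 \<le> (\<integral>x. f x * h x \<partial>M)"
proof -
  define P where "P x = max 0 (f x)" for x
  define N where "N x = max 0 (- f x)" for x
  have P_nonneg: "0 \<le> P x" and N_nonneg: "0 \<le> N x" for x
    by (auto simp: P_def N_def)
  have parts: "integrable M (\<lambda>x. P x * w x) \<and> integrable M (\<lambda>x. N x * w x) \<and>
      (\<integral>x. f x * w x \<partial>M) = (\<integral>x. P x * w x \<partial>M) - (\<integral>x. N x * w x \<partial>M)"
    if w: "\<And>x. 0 \<le> w x" and fw: "integrable M (\<lambda>x. f x * w x)" for w :: "real \<Rightarrow> real"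
  proof -
    \<comment> \<open>A nonnegative weight commutes with taking positive and negative parts, so
      integrability passes from \<open>f x * w x\<close> to both parts.\<close>
    have "P x * w x = max 0 (f x * w x)" "N x * w x = max 0 (- (f x * w x))" for x
      using w[of x] by (auto simp: P_def N_def max_def mult_le_0_iff zero_le_mult_iff)
    then have int: "integrable M (\<lambda>x. P x * w x)" "integrable M (\<lambda>x. N x * w x)"
      using fw by simp_all
    have "f x * w x = P x * w x - N x * w x" for x
      by (auto simp: P_def N_def max_def)
    with int show ?thesis by simp
  qed
  note g_parts = parts[OF g fg] and h_parts = parts[OF h fh]
  let ?Pg = "\<integral>x. P x * g x \<partial>M" and ?Ng = "\<integral>x. N x * g x \<partial>M"
  let ?Ph = "\<integral>x. P x * h x \<partial>M" and ?Nh = "\<integral>x. N x * h x \<partial>M"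
  have kernel: "N x * h x * (P y * g y) \<le> N x * g x * (P y * h y)" for x y
  proof (cases "f x < 0 \<and> 0 < f y")
    case True
    \<comment> \<open>If y < x, then \<open>0 < f y\<close> would force
      \<open>0 \<le> f x\<close>.\<close>
    then have "x \<le> y"
      using f unfolding single_crossing_on_def by (meson UNIV_I linorder_le_cases not_less)
    then have "(N x * P y) * (h x * g y) \<le> (N x * P y) * (g x * h y)"
      using gh P_nonneg N_nonneg by (intro mult_left_mono) auto
    then show ?thesis by (simp add: mult_ac)
  qed (auto simp: P_def N_def max_def)
  \<comment> \<open>Integrating \<open>kernel\<close> first in y, then in x, keeps the other
    variable's factors constant, so no product measure is involved.\<close>
  have "N x * h x * ?Pg \<le> N x * g x * ?Ph" for x
    using integral_mono[of M "\<lambda>y. N x * h x * (P y * g y)" "\<lambda>y. N x * g x * (P y * h y)"]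
      kernel g_parts h_parts by simp
  then have le: "?Nh * ?Pg \<le> ?Ng * ?Ph"
    using integral_mono[of M "\<lambda>x. N x * h x * ?Pg" "\<lambda>x. N x * g x * ?Ph"] g_parts h_parts
    by simp
  have Ng: "0 \<le> ?Ng" and Ph: "0 \<le> ?Ph"
    using P_nonneg N_nonneg g h by simp_all
  have "?Ng < ?Pg" using pos g_parts by simp
  have "?Nh * ?Pg \<le> ?Ph * ?Pg"
    using le mult_right_mono[of ?Ng ?Pg ?Ph] \<open>?Ng < ?Pg\<close> Ph by (simp add: mult.commute)
  \<comment> \<open>The factor \<open>?Pg\<close> cancels, being strictly positive.\<close>
  with Ng \<open>?Ng < ?Pg\<close> have "?Nh \<le> ?Ph" by simp
  with h_parts show ?thesis by simp
qed

theorem lemma6: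
  fixes I :: "real set" and \<phi> \<kappa> :: "real \<Rightarrow> real \<Rightarrow> real"
  assumes "is_interval I"
    and "\<And>l m. m \<in> I \<Longrightarrow> \<kappa> l m \<ge> 0"
    and "TP2_on I \<kappa>"
    and "\<And>m. m \<in> I \<Longrightarrow> single_crossing_on UNIV (\<lambda>l. \<phi> l m)"
    and "\<exists>mlo mhi :: ereal. mlo \<le> mhi \<and>
           (\<forall>l. (\<forall>m\<in>I. ereal m \<le> mlo \<longrightarrow> \<phi> l m \<le> 0) \<and>
                mono_on {m \<in> I. mlo < ereal m \<and> ereal m < mhi} (\<lambda>m. \<phi> l m) \<and>
                (\<forall>m\<in>I. mhi \<le> ereal m \<longrightarrow> \<phi> l m \<ge> 0))"
    and "\<And>l m. l \<in> I \<Longrightarrow> m \<in> I \<Longrightarrow> integrable lebesgue (\<lambda>k. \<phi> k l * \<kappa> k m)"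
  shows "single_crossing_on I (\<lambda>m. \<integral>l. \<phi> l m * \<kappa> l m \<partial>lebesgue)"
  unfolding single_crossing_on_def
proof (intro ballI impI)
  fix m m' assume m: "m \<in> I" and m': "m' \<in> I" and "m \<le> m'"
    and pos: "0 < (\<integral>l. \<phi> l m * \<kappa> l m \<partial>lebesgue)"
  obtain mlo mhi :: ereal
    where lo: "\<And>l m. m \<in> I \<Longrightarrow> ereal m \<le> mlo \<Longrightarrow> \<phi> l m \<le> 0"
      and mono: "\<And>l. mono_on {m \<in> I. mlo < ereal m \<and> ereal m < mhi} (\<lambda>m. \<phi> l m)"
      and hi: "\<And>l m. m \<in> I \<Longrightarrow> mhi \<le> ereal m \<Longrightarrow> 0 \<le> \<phi> l m"
    using assms(5) by blast
  show "0 \<le> (\<integral>l. \<phi> l m' * \<kappa> l m' \<partial>lebesgue)"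
  proof (cases "mhi \<le> ereal m'")
    case True
    then show ?thesis using hi assms(2) m' by simp
  next
    case False
    \<comment> \<open>Otherwise \<open>\<phi> l m\<close> is nonpositive for every l, contradicting
      the positive integral at m.\<close>
    have "mlo < ereal m"
    proof (rule ccontr)
      assume "\<not> mlo < ereal m"
      then have "0 \<le> (\<integral>l. - (\<phi> l m * \<kappa> l m) \<partial>lebesgue)"
        using lo assms(2) m by (intro integral_nonneg_AE) (auto simp: mult_le_0_iff)
      with pos show False by simp
    qed
    moreover have "ereal m \<le> ereal m'" and "ereal m' < mhi"
      using \<open>m \<le> m'\<close> False by simp_all
    ultimately have "mlo < ereal m'" and "ereal m < mhi"
      by (blast intro: less_le_trans le_less_trans)+
    then have "\<phi> l m \<le> \<phi> l m'" for l
      using mono_onD[OF mono, of m m' l] \<open>mlo < ereal m\<close> \<open>ereal m' < mhi\<close> m m' \<open>m \<le> m'\<close> by simp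
    \<comment> \<open>The mixed integrand on the right is why integrability is assumed for two
      independent parameters.\<close>
    then have "(\<integral>l. \<phi> l m * \<kappa> l m \<partial>lebesgue) \<le> (\<integral>l. \<phi> l m' * \<kappa> l m \<partial>lebesgue)"
      using assms(2,6) m m' by (intro integral_mono mult_right_mono) auto
    with pos have "0 < (\<integral>l. \<phi> l m' * \<kappa> l m \<partial>lebesgue)" by simp
    moreover have "\<kappa> x m' * \<kappa> y m \<le> \<kappa> x m * \<kappa> y m'" if "x \<le> y" for x y
      using assms(3) that m m' \<open>m \<le> m'\<close> unfolding TP2_on_def by blast
    ultimately show ?thesis
      using integral_single_crossing_change_weight
        [of "\<lambda>l. \<phi> l m'" "\<lambda>l. \<kappa> l m" "\<lambda>l. \<kappa> l m'" lebesgue] assms(2,4,6) m m'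
      by blast
  qed
qed

end
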